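(* Suppose $(V,\|\cdot\|)$ is a normed real vector space with distance $d(x,y)=\|x-y\|$. Then $(V,d)$ is rCAT(0) if and only if it is CAT(0).
   Context: CAT(0) spaces are (not necessarily complete) geodesic metric spaces all of whose geodesic triangles satisfy the usual Euclidean comparison inequality. For $h\ge 0$, an $h$-short segment $[x,y]_h$ from $x$ to $y$ in a metric space $(X,d)$ is a path $\gamma:[0,L]\to X$ from $x$ to $y$ with $\mathrm{len}(\gamma)\le d(x,y)+h$. For a point $u=\gamma(t)$ on it, $[x,u]_h$ and $[u,y]_h$ denote the subpaths $\gamma|_{[0,t]}$ and $\gamma|_{[t,L]}$. An $h$-short triangle $T_h(x,y,z)$ consists of $x,y,z\in X$ with a choice of $h$-short segments (sides) $[x,y]_h,[y,z]_h,[z,x]_h$. A comparison triangle is a Euclidean triangle $T(\bar x,\bar y,\bar z)$ in the plane with $|\bar x-\bar y|=d(x,y)$, $|\bar y-\bar z|=d(y,z)$, $|\bar z-\bar x|=d(z,x)$. A comparison point for $u\in[x,y]_h$ is any $\bar u\in[\bar x,\bar y]$ with $|\bar x-\bar u|\le\mathrm{len}([x,u]_h)$ and $|\bar u-\bar y|\le\mathrm{len}([u,y]_h)$ (not necessarily unique); similarly for the other sides. A length space $X$ is rCAT(0) if there is $C>0$ such that for all $x,y,z\in X$ and every $h$-short triangle $T_h(x,y,z)$ with $h=1/\max\{1,d(x,y),d(x,z),d(y,z)\}$, one has $d(u,v)\le|\bar u-\bar v|+C$ whenever $u,v$ lie on different sides of $T_h(x,y,z)$ and $\bar u,\bar v$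 are corresponding comparison points on a comparison triangle. *)

theory Defs
  imports "HOL-Analysis.Analysis"
begin

text \<open>
  A metric space is a set \<open>X\<close> in a type of class \<^class>\<open>metric_space\<close>, with the
  distance \<^const>\<open>dist\<close>. A path in \<open>X\<close> is given by a function \<open>g\<close> on the reals together
  with a length \<open>L\<close> of the parameter interval; only the restriction of \<open>g\<close> to
  \<open>{0..L}\<close> matters, and the parametrisation is arbitrary unless stated otherwise.
\<close>

definition path_from_to ::
    "'a::metric_space set \<Rightarrow> (real \<Rightarrow> 'a) \<Rightarrow> real \<Rightarrow> 'a \<Rightarrow> 'a \<Rightarrow> bool" where
  "path_from_to X g L x y \<longleftrightarrow>
     0 \<le> L \<and> continuous_on {0..L} g \<and> g ` {0..L} \<subseteq> X \<and> g 0 = x \<and> g L = y"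

text \<open>
  The length of \<open>g\<close> restricted to \<open>{a..b}\<close>, as a supremum over finite nondecreasing sequences
  of parameters; it is infinite if the path is not rectifiable.
\<close>

definition path_len :: "(real \<Rightarrow> 'a::metric_space) \<Rightarrow> real \<Rightarrow> real \<Rightarrow> ereal" where
  "path_len g a b =
     (SUP ts \<in> {ts. sorted ts \<and> set ts \<subseteq> {a..b}}.
        ereal (\<Sum>i<length ts - 1. dist (g (ts ! i)) (g (ts ! Suc i))))"

text \<open>The infimum is infinite if no path in \<open>X\<close> joins the two points.\<close>

definition length_space :: "'a::metric_space set \<Rightarrow> bool" where
  "length_space X \<longleftrightarrow>
     (\<forall>x\<in>X. \<forall>y\<in>X.
        ereal (dist x y) = (INF (g, L) \<in> {(g, L). path_from_to X g L x y}. path_len g 0 L))"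

definition short_segment ::
    "real \<Rightarrow> 'a::metric_space set \<Rightarrow> (real \<Rightarrow> 'a) \<Rightarrow> real \<Rightarrow> 'a \<Rightarrow> 'a \<Rightarrow> bool" where
  "short_segment h X g L x y \<longleftrightarrow>
     path_from_to X g L x y \<and> path_len g 0 L \<le> ereal (dist x y + h)"

definition geodesic_segment ::
    "'a::metric_space set \<Rightarrow> (real \<Rightarrow> 'a) \<Rightarrow> real \<Rightarrow> 'a \<Rightarrow> 'a \<Rightarrow> bool" where
  "geodesic_segment X g L x y \<longleftrightarrow>
     path_from_to X g L x y \<and> (\<forall>s\<in>{0..L}. \<forall>t\<in>{0..L}. dist (g s) (g t) = \<bar>s - t\<bar>)"

definition geodesic_space :: "'a::metric_space set \<Rightarrow> bool" where
  "geodesic_space X \<longleftrightarrow> (\<forall>x\<in>X. \<forall>y\<in>X. \<exists>g L. geodesic_segment X g L x y)"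

definition comparison_triangle ::
    "'a::metric_space \<Rightarrow> 'a \<Rightarrow> 'a \<Rightarrow> real^2 \<Rightarrow> real^2 \<Rightarrow> real^2 \<Rightarrow> bool" where
  "comparison_triangle x y z x' y' z' \<longleftrightarrow>
     dist x' y' = dist x y \<and> dist y' z' = dist y z \<and> dist z' x' = dist z x"

text \<open>
  The pairs of a point \<open>u\<close> on a side and a comparison point \<open>u'\<close> for it on the comparison side
  from \<open>x'\<close> to \<open>y'\<close>. A short segment may pass through \<open>u\<close> several times, and the subpaths from
  \<open>x\<close> to \<open>u\<close> and from \<open>u\<close> to \<open>y\<close> depend on the parameter \<open>t\<close> with \<open>u = g t\<close>; all such \<open>t\<close>
  are admitted.
\<close>

definition short_comparison ::
    "(real \<Rightarrow> 'a::metric_space) \<Rightarrow> real \<Rightarrow> real^2 \<Rightarrow> real^2 \<Rightarrow> ('a \<times> (real^2)) set" where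
  "short_comparison g L x' y' =
     {(g t, u') | t u'. t \<in> {0..L} \<and> u' \<in> closed_segment x' y' \<and>
        ereal (dist x' u') \<le> path_len g 0 t \<and> ereal (dist u' y') \<le> path_len g t L}"

definition geodesic_comparison ::
    "(real \<Rightarrow> 'a::metric_space) \<Rightarrow> real \<Rightarrow> real^2 \<Rightarrow> real^2 \<Rightarrow> ('a \<times> (real^2)) set" where
  "geodesic_comparison g L x' y' =
     {(g t, u') | t u'. t \<in> {0..L} \<and> u' \<in> closed_segment x' y' \<and>
        dist x' u' = dist (g 0) (g t) \<and> dist u' y' = dist (g t) (g L)}"

definition comparison_ineq ::
    "real \<Rightarrow> ('a::metric_space \<times> (real^2)) set \<Rightarrow> ('a \<times> (real^2)) set \<Rightarrow> bool" where
  "comparison_ineq C S T \<longleftrightarrow>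
     (\<forall>(u, u')\<in>S. \<forall>(v, v')\<in>T. dist u v \<le> dist u' v' + C)"

text \<open>
  In the next two definitions \<open>(a, A)\<close>, \<open>(b, B)\<close>, \<open>(c, C)\<close> are the sides from \<open>x\<close> to \<open>y\<close>,
  from \<open>y\<close> to \<open>z\<close> and from \<open>z\<close> to \<open>x\<close>. Completeness is not required for CAT(0), and there the
  inequality is imposed for all pairs of points of the triangle.
\<close>

definition CAT0_space :: "'a::metric_space set \<Rightarrow> bool" where
  "CAT0_space X \<longleftrightarrow>
     geodesic_space X \<and>
     (\<forall>x\<in>X. \<forall>y\<in>X. \<forall>z\<in>X. \<forall>a A b B c C x' y' z'.
        geodesic_segment X a A x y \<and> geodesic_segment X b B y z \<and> geodesic_segment X c C z x \<and>
        comparison_triangle x y z x' y' z' \<longrightarrow>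
        (let P = geodesic_comparison a A x' y' \<union> geodesic_comparison b B y' z' \<union>
                 geodesic_comparison c C z' x'
         in comparison_ineq 0 P P))"

definition rCAT0_space :: "'a::metric_space set \<Rightarrow> bool" where
  "rCAT0_space X \<longleftrightarrow>
     length_space X \<and>
     (\<exists>K>0. \<forall>x\<in>X. \<forall>y\<in>X. \<forall>z\<in>X. \<forall>a A b B c C x' y' z'.
        let h = 1 / Max {1, dist x y, dist x z, dist y z} in
        short_segment h X a A x y \<and> short_segment h X b B y z \<and> short_segment h X c C z x \<and>
        comparison_triangle x y z x' y' z' \<longrightarrow>
        (let P = short_comparison a A x' y'; Q = short_comparison b B y' z';
             R = short_comparison c C z' x'
         in comparison_ineq K P Q \<and> comparison_ineq K Q R \<and> comparison_ineq K P R))"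

end

(* Straight segments are geodesics in a normed space. Comparing the midpoint of one side of a
   triangle with the opposite vertex, with an additive error that disappears after scaling, gives
   the parallelogram inequality; substituting x + y and x - y turns it into the parallelogram law.
   Conversely, the parallelogram law yields Stewart's identity for the distance from a point to the
   points of a segment. It makes geodesics straight, makes distances between points of two triangles
   with equal side lengths agree, and puts each point of an h-short segment at distance at most
   sqrt (d h + h^2) from the point of the straight segment with the same comparison point. *)
theory Submission
  imports Defs
begin

section \<open>Stewart's identity\<close>

text \<open>Reflection at a maximum: if the maximum \<open>p s\<close> over the unit interval were
  positive, reflecting the endpoint nearer to \<open>s\<close> would give a point of the interval
  with value \<open>2 * p s\<close>. Applied to \<open>p\<close> and to \<open>- p\<close> it yields
  that \<open>p\<close> vanishes on the interval.\<close>

lemma midpoint_affine_zero_le: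
  fixes p :: "real \<Rightarrow> real"
  assumes cont: "continuous_on {0..1} p" and "p 0 = 0" "p 1 = 0"
    and mid: "\<And>s t. p (s + t) + p (s - t) = 2 * p s"
    and r: "r \<in> {0..1}"
  shows "p r \<le> 0"
proof (rule ccontr)
  assume "\<not> p r \<le> 0"
  obtain s where s: "s \<in> {0..1}" and max: "\<And>t. t \<in> {0..1} \<Longrightarrow> p t \<le> p s"
    using continuous_attains_sup[OF compact_Icc _ cont] by auto
  have pos: "p s > 0"
    using max[OF r] \<open>\<not> p r \<le> 0\<close> by linarith
  show False
  proof (cases "s \<le> 1/2")
    case True
    then have "p (2 * s) \<le> p s"
      using s by (intro max) auto
    moreover have "p (2 * s) + p 0 = 2 * p s"
      using mid[of s s] by simp
    ultimately show False
      using pos assms(2) by linarith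
  next
    case False
    then have "p (2 * s - 1) \<le> p s"
      using s by (intro max) auto
    moreover have "p 1 + p (2 * s - 1) = 2 * p s"
      using mid[of s "1 - s"] by (simp add: algebra_simps)
    ultimately show False
      using pos assms(3) by linarith
  qed
qed

text \<open>Along a line the parallelogram law fixes the second difference of the squared norm, so
  continuity and the values at the two ends determine it between them. No inner product has to be
  constructed.\<close>

lemma stewart_parallelogram:
  fixes x y w :: "'a::real_normed_vector"
  assumes par: "\<And>x y :: 'a. (norm (x + y))\<^sup>2 + (norm (x - y))\<^sup>2 = 2 * (norm x)\<^sup>2 + 2 * (norm y)\<^sup>2"
    and r: "0 \<le> r" "r \<le> 1"
  shows "(dist ((1 - r) *\<^sub>R x + r *\<^sub>R y) w)\<^sup>2 =
    (1 - r) * (dist x w)\<^sup>2 + r * (dist y w)\<^sup>2 - r * (1 - r) * (dist x y)\<^sup>2"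
proof -
  define a b where "a = x - w" and "b = y - x"
  \<comment> \<open>The deviation of the squared norm from the quadratic in \<open>s\<close> that
    has leading coefficient \<open>(norm b)\<^sup>2\<close> and the right values at 0 and 1.\<close>
  define p where "p s = (norm (a + s *\<^sub>R b))\<^sup>2 - s\<^sup>2 * (norm b)\<^sup>2 - (norm a)\<^sup>2
    - s * ((norm (a + b))\<^sup>2 - (norm b)\<^sup>2 - (norm a)\<^sup>2)" for s
  have mid: "p (s + t) + p (s - t) = 2 * p s" for s t
  proof -
    have "(norm (a + (s + t) *\<^sub>R b))\<^sup>2 + (norm (a + (s - t) *\<^sub>R b))\<^sup>2
        = 2 * (norm (a + s *\<^sub>R b))\<^sup>2 + 2 * (t\<^sup>2 * (norm b)\<^sup>2)"
      using par[of "a + s *\<^sub>R b" "t *\<^sub>R b"]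
      by (simp add: algebra_simps power_mult_distrib)
    then show ?thesis
      unfolding p_def by (simp add: algebra_simps power2_eq_square)
  qed
  have cont: "continuous_on {0..1} p"
    unfolding p_def by (intro continuous_intros)
  have p01: "p 0 = 0" "p 1 = 0"
    by (auto simp: p_def)
  have "p r \<le> 0"
    using midpoint_affine_zero_le[OF cont p01 mid] r by simp
  moreover have "- p r \<le> 0"
  proof (rule midpoint_affine_zero_le[where p = "\<lambda>s. - p s"])
    show "- p (s + t) + - p (s - t) = 2 * - p s" for s t
      using mid[of s t] by linarith
  qed (use cont p01 r in \<open>auto intro: continuous_on_minus\<close>)
  ultimately have "p r = 0"
    by simp
  moreover have "norm (a + r *\<^sub>R b) = dist ((1 - r) *\<^sub>R x + r *\<^sub>R y) w"
    by (simp add: a_def b_def dist_norm algebra_simps)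
  moreover have "norm a = dist x w" "norm (a + b) = dist y w" "norm b = dist x y"
    by (simp_all add: a_def b_def dist_norm norm_minus_commute)
  ultimately show ?thesis
    by (simp add: p_def algebra_simps power2_eq_square)
qed

text \<open>Serves for the comparison plane, so that distances in the space and in the plane are
  computed by one and the same formula.\<close>

lemma stewart_inner:
  fixes x y w :: "'a::real_inner"
  shows "(dist ((1 - r) *\<^sub>R x + r *\<^sub>R y) w)\<^sup>2 =
    (1 - r) * (dist x w)\<^sup>2 + r * (dist y w)\<^sup>2 - r * (1 - r) * (dist x y)\<^sup>2"
  unfolding dist_norm power2_norm_eq_inner
  by (simp add: inner_diff inner_add inner_commute algebra_simps)

section \<open>Comparison triangles\<close>

text \<open>The first side is laid on the horizontal axis starting at the origin; the law of cosines
  gives the first coordinate \<open>p\<close> of the third vertex. The case \<open>x = y\<close> is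
  separate because \<open>p\<close> is a quotient by the length of that side.\<close>

lemma comparison_triangle_exists:
  fixes x y z :: "'a::metric_space"
  shows "\<exists>x' y' z'. comparison_triangle x y z x' y' z'"
proof -
  have dist_vec2: "dist u v = sqrt ((u$1 - v$1)\<^sup>2 + (u$2 - v$2)\<^sup>2)" for u v :: "real^2"
    by (simp add: dist_vec_def L2_set_def sum_2 dist_real_def)
  show ?thesis
  proof (cases "x = y")
    case True
    have "comparison_triangle x y z (0::real^2) 0 (vector [dist y z, 0])"
      using True by (simp add: comparison_triangle_def dist_vec2 dist_commute)
    then show ?thesis by blast
  next
    case False
    define a b c where "a = dist y z" and "b = dist z x" and "c = dist x y"
    have c: "c > 0" using False by (simp add: c_def)
    have nn: "a \<ge> 0" "b \<ge> 0" by (auto simp: a_def b_def)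
    have tri: "a \<le> b + c" "b \<le> a + c" "c \<le> a + b"
      unfolding a_def b_def c_def
      by (metis dist_commute dist_triangle add.commute)+
    define p where "p = (b\<^sup>2 + c\<^sup>2 - a\<^sup>2) / (2 * c)"
    have cp: "2 * c * p = b\<^sup>2 + c\<^sup>2 - a\<^sup>2"
      using c by (simp add: p_def)
    \<comment> \<open>The squared triangle inequalities are, up to the factor \<open>2 * c\<close>,
      the bounds of \<open>p\<close> by \<open>b\<close> in absolute value, which make the square
      root below real.\<close>
    have "a\<^sup>2 \<le> (b + c)\<^sup>2"
      using tri nn by (intro power_mono) auto
    moreover have "(b - c)\<^sup>2 \<le> a\<^sup>2"
      using tri nn by (intro iffD1[OF abs_le_square_iff]) auto
    ultimately have "2 * c * p \<le> 2 * c * b" "2 * c * (- p) \<le> 2 * c * b"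
      using cp by (auto simp: power2_eq_square algebra_simps)
    then have "p \<le> b" "- p \<le> b"
      using c by (simp_all only: mult_le_cancel_left_pos zero_less_mult_iff zero_less_numeral simp_thms)
    then have p2: "p\<^sup>2 \<le> b\<^sup>2"
      using nn by (intro iffD1[OF abs_le_square_iff]) auto
    have "(c - p)\<^sup>2 + (b\<^sup>2 - p\<^sup>2) = a\<^sup>2"
      using cp by (simp add: power2_eq_square algebra_simps)
    then have "comparison_triangle x y z (0::real^2) (vector [c, 0]) (vector [p, sqrt (b\<^sup>2 - p\<^sup>2)])"
      using p2 nn c unfolding comparison_triangle_def a_def[symmetric] b_def[symmetric] c_def[symmetric]
      by (simp add: dist_vec2)
    then show ?thesis by blast
  qed
qed

section \<open>Straight segments\<close>

text \<open>For \<^term>\<open>x = y\<close> the division by zero gives the constant map.\<close>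

definition straight :: "'a::real_normed_vector \<Rightarrow> 'a \<Rightarrow> real \<Rightarrow> 'a" where
  "straight x y t = x + (t / dist x y) *\<^sub>R (y - x)"

lemma straight_0 [simp]: "straight x y 0 = x"
  by (simp add: straight_def)

lemma straight_dist [simp]: "straight x y (dist x y) = y"
  by (simp add: straight_def)

lemma straight_half: "straight x y (dist x y / 2) = midpoint x y"
proof (cases "x = y")
  case False
  then show ?thesis
    by (simp add: straight_def midpoint_def algebra_simps flip: scaleR_add_left)
qed (simp add: straight_def)

lemma geodesic_straight: "geodesic_segment UNIV (straight x y) (dist x y) x y"
  unfolding geodesic_segment_def path_from_to_def
proof (intro conjI ballI)
  show "continuous_on {0..dist x y} (straight x y)"
    unfolding straight_def divide_inverse by (intro continuous_intros)
  fix s t assume "s \<in> {0..dist x y}" "t \<in> {0..dist x y}"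
  then show "dist (straight x y s) (straight x y t) = \<bar>s - t\<bar>"
  proof (cases "x = y")
    case False
    have "straight x y s - straight x y t = ((s - t) / dist x y) *\<^sub>R (y - x)"
      by (simp add: straight_def algebra_simps diff_divide_distrib)
    then show ?thesis
      using False by (simp add: dist_norm norm_minus_commute)
  qed simp
qed auto

lemma geodesic_space_UNIV: "geodesic_space (UNIV :: 'a::real_normed_vector set)"
  using geodesic_straight unfolding geodesic_space_def by blast

section \<open>Lengths of paths\<close>

lemma path_len_ge_sum:
  assumes "sorted ts" "set ts \<subseteq> {a..b}"
  shows "ereal (\<Sum>i<length ts - 1. dist (g (ts ! i)) (g (ts ! Suc i))) \<le> path_len g a b"
  unfolding path_len_def using assms by (intro SUP_upper) auto

lemma path_len_ge_dist:
  assumes "a \<le> b"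
  shows "ereal (dist (g a) (g b)) \<le> path_len g a b"
  using path_len_ge_sum[of "[a, b]" a b g] assms by simp

text \<open>Every polygonal sum along a geodesic telescopes to a difference of two parameters; the
  opposite bound comes from the two-point sum.\<close>

lemma path_len_geodesic:
  assumes "geodesic_segment X g L x y"
  shows "path_len g 0 L = ereal (dist x y)"
proof (rule antisym)
  have L: "0 \<le> L" and ends: "g 0 = x" "g L = y"
    and iso: "\<And>s t. s \<in> {0..L} \<Longrightarrow> t \<in> {0..L} \<Longrightarrow> dist (g s) (g t) = \<bar>s - t\<bar>"
    using assms by (auto simp: geodesic_segment_def path_from_to_def)
  have dist: "dist x y = L"
    using iso[of 0 L] L ends by simp
  show "ereal (dist x y) \<le> path_len g 0 L"
    using path_len_ge_dist[OF L, of g] ends by simp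
  show "path_len g 0 L \<le> ereal (dist x y)"
    unfolding path_len_def
  proof (rule SUP_least)
    fix ts :: "real list" assume "ts \<in> {ts. sorted ts \<and> set ts \<subseteq> {0..L}}"
    then have ts: "sorted ts" "set ts \<subseteq> {0..L}" by auto
    have "(\<Sum>i<length ts - 1. dist (g (ts ! i)) (g (ts ! Suc i)))
        = (\<Sum>i<length ts - 1. ts ! Suc i - ts ! i)"
    proof (rule sum.cong[OF refl])
      fix i assume "i \<in> {..<length ts - 1}"
      then have i: "Suc i < length ts" by auto
      then have "ts ! i \<in> {0..L}" "ts ! Suc i \<in> {0..L}"
        using ts(2) nth_mem[of i ts] nth_mem[of "Suc i" ts] by (meson Suc_lessD subsetD)+
      moreover have "ts ! i \<le> ts ! Suc i"
        using ts(1) i by (simp add: sorted_iff_nth_mono)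
      ultimately show "dist (g (ts ! i)) (g (ts ! Suc i)) = ts ! Suc i - ts ! i"
        by (simp add: iso)
    qed
    also have "\<dots> = ts ! (length ts - 1) - ts ! 0"
      by (rule sum_lessThan_telescope)
    also have "\<dots> \<le> L"
    proof (cases "ts = []")
      case False
      then have "ts ! (length ts - 1) \<in> {0..L}" "ts ! 0 \<in> {0..L}"
        using ts(2) nth_mem[of "length ts - 1" ts] nth_mem[of 0 ts] by (auto simp del: nth_mem)
      then show ?thesis by simp
    \<comment> \<open>For the empty list truncated subtraction makes both indices 0, so the
      difference is zero.\<close>
    qed (use L in simp)
    finally show "ereal (\<Sum>i<length ts - 1. dist (g (ts ! i)) (g (ts ! Suc i))) \<le> ereal (dist x y)"
      by (simp add: dist)
  qed
qed

lemma short_straight: "0 \<le> h \<Longrightarrow> short_segment h UNIV (straight x y) (dist x y) x y"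
  using geodesic_straight[of x y] path_len_geodesic[OF geodesic_straight[of x y]]
  by (auto simp: short_segment_def geodesic_segment_def)

lemma length_space_UNIV: "length_space (UNIV :: 'a::real_normed_vector set)"
  unfolding length_space_def
proof (intro ballI antisym)
  fix x y :: 'a
  show "ereal (dist x y) \<le> (INF (g, L)\<in>{(g, L). path_from_to UNIV g L x y}. path_len g 0 L)"
    using path_len_ge_dist by (intro INF_greatest) (auto simp: path_from_to_def)
  have "(straight x y, dist x y) \<in> {(g, L). path_from_to UNIV g L x y}"
    using geodesic_straight[of x y] by (simp add: geodesic_segment_def)
  then show "(INF (g, L)\<in>{(g, L). path_from_to UNIV g L x y}. path_len g 0 L) \<le> ereal (dist x y)"
    by (rule INF_lower2) (simp add: path_len_geodesic[OF geodesic_straight])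
qed

section \<open>The parallelogram law from comparison of medians\<close>

text \<open>The common core of both forward directions: \<open>K\<close> will be the rCAT(0)
  constant or 0. Dilations preserve comparison triangles but multiply any defect in the comparison,
  so a bounded defect must be absent.\<close>

lemma parallelogram_of_median_comparison:
  fixes a b :: "'a::real_normed_vector"
  assumes med: "\<And>(x::'a) y z x' y' z'. comparison_triangle x y z x' y' z' \<Longrightarrow>
    dist (midpoint x y) z \<le> dist (midpoint x' y') z' + K"
  shows "(norm (a + b))\<^sup>2 + (norm (a - b))\<^sup>2 = 2 * (norm a)\<^sup>2 + 2 * (norm b)\<^sup>2"
proof -
  have exact: "dist (midpoint x y) z \<le> dist (midpoint x' y') z'"
    if tri: "comparison_triangle x y z x' y' z'" for x y z :: 'a and x' y' z'
  proof (rule ccontr)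
    define e where "e = dist (midpoint x y) z - dist (midpoint x' y') z'"
    assume "\<not> dist (midpoint x y) z \<le> dist (midpoint x' y') z'"
    then have e: "e > 0" by (simp add: e_def)
    \<comment> \<open>Chosen so that the dilated defect \<open>R * e\<close> is
      \<open>\<bar>K\<bar> + 1\<close>, which exceeds \<open>K\<close>.\<close>
    define R where "R = (\<bar>K\<bar> + 1) / e"
    have R: "R > 0" using e by (simp add: R_def add_nonneg_pos)
    have scale: "dist (R *\<^sub>R u) (R *\<^sub>R v) = R * dist u v" for u v :: "'b::real_normed_vector"
      using R by (simp add: dist_norm flip: scaleR_diff_right)
    have mid: "midpoint (R *\<^sub>R u) (R *\<^sub>R v) = R *\<^sub>R midpoint u v" for u v :: "'b::real_normed_vector"
      by (simp add: midpoint_def scaleR_add_right)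
    have "comparison_triangle (R *\<^sub>R x) (R *\<^sub>R y) (R *\<^sub>R z) (R *\<^sub>R x') (R *\<^sub>R y') (R *\<^sub>R z')"
      using tri by (simp add: comparison_triangle_def scale)
    from med[OF this] have "R * e \<le> K"
      by (simp add: mid scale e_def algebra_simps)
    moreover have "R * e = \<bar>K\<bar> + 1" using e by (simp add: R_def)
    ultimately show False by linarith
  qed
  have ineq: "(norm (x + y))\<^sup>2 + (norm (x - y))\<^sup>2 \<le> 2 * (norm x)\<^sup>2 + 2 * (norm y)\<^sup>2" for x y :: 'a
  proof -
    \<comment> \<open>With the third vertex at the origin the median has length
      \<open>norm (x + y) / 2\<close>.\<close>
    obtain x' y' z' where tri: "comparison_triangle x y 0 x' y' z'"
      using comparison_triangle_exists by blast
    have "midpoint x' y' = (1 - 1/2) *\<^sub>R x' + (1/2) *\<^sub>R y'"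
      by (simp add: midpoint_def scaleR_add_right)
    then have "(dist (midpoint x' y') z')\<^sup>2
        = (norm x)\<^sup>2 / 2 + (norm y)\<^sup>2 / 2 - (norm (x - y))\<^sup>2 / 4"
      using tri stewart_inner[of "1/2" x' y' z']
      by (simp add: comparison_triangle_def dist_norm norm_minus_commute)
    moreover have "(dist (midpoint x y) 0)\<^sup>2 \<le> (dist (midpoint x' y') z')\<^sup>2"
      using exact[OF tri] by (rule power_mono) simp
    moreover have "(dist (midpoint x y) 0)\<^sup>2 = (norm (x + y))\<^sup>2 / 4"
      by (simp add: midpoint_def power_divide)
    ultimately show ?thesis by linarith
  qed
  have double: "(norm (v + v))\<^sup>2 = 4 * (norm v)\<^sup>2" for v :: 'a
    by (simp add: power_mult_distrib flip: scaleR_2)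
  have "4 * (norm a)\<^sup>2 + 4 * (norm b)\<^sup>2 \<le> 2 * (norm (a + b))\<^sup>2 + 2 * (norm (a - b))\<^sup>2"
    using ineq[of "a + b" "a - b"] double[of a] double[of b] by simp
  with ineq[of a b] show ?thesis by linarith
qed

text \<open>Straight segments are admissible short sides. Since only points on different sides are
  compared, the vertex \<open>z\<close> is taken as the end of the second side.\<close>

lemma parallelogram_of_rCAT0:
  fixes a b :: "'a::real_normed_vector"
  assumes "rCAT0_space (UNIV :: 'a set)"
  shows "(norm (a + b))\<^sup>2 + (norm (a - b))\<^sup>2 = 2 * (norm a)\<^sup>2 + 2 * (norm b)\<^sup>2"
proof -
  obtain K where K: "\<forall>x\<in>UNIV. \<forall>y\<in>UNIV. \<forall>z\<in>UNIV. \<forall>a A b B c C x' y' z'.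
      short_segment (1 / Max {1, dist x y, dist x z, dist y z}) (UNIV :: 'a set) a A x y \<and>
      short_segment (1 / Max {1, dist x y, dist x z, dist y z}) UNIV b B y z \<and>
      short_segment (1 / Max {1, dist x y, dist x z, dist y z}) UNIV c C z x \<and>
      comparison_triangle x y z x' y' z' \<longrightarrow>
      comparison_ineq K (short_comparison a A x' y') (short_comparison b B y' z') \<and>
      comparison_ineq K (short_comparison b B y' z') (short_comparison c C z' x') \<and>
      comparison_ineq K (short_comparison a A x' y') (short_comparison c C z' x')"
    using assms unfolding rCAT0_space_def Let_def by (elim conjE exE)
  show ?thesis
  proof (rule parallelogram_of_median_comparison)
    fix x y z :: 'a and x' y' z' :: "real^2"
    assume tri: "comparison_triangle x y z x' y' z'"
    define h where "h = 1 / Max {1, dist x y, dist x z, dist y z}"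
    have h: "0 \<le> h"
      unfolding h_def by (simp add: le_max_iff_disj)
    have d: "dist x' y' = dist x y" "dist y' z' = dist y z"
      using tri by (auto simp: comparison_triangle_def)
    let ?g = "straight x y" and ?L = "dist x y"
    have iso: "\<And>s t. s \<in> {0..?L} \<Longrightarrow> t \<in> {0..?L} \<Longrightarrow> dist (?g s) (?g t) = \<bar>s - t\<bar>"
      using geodesic_straight[of x y] by (auto simp: geodesic_segment_def)
    have half: "dist (?g 0) (?g (?L / 2)) = ?L / 2" "dist (?g (?L / 2)) (?g ?L) = ?L / 2"
      using iso[of 0 "?L / 2"] iso[of "?L / 2" ?L] by simp_all
    \<comment> \<open>A comparison point only needs its distances to be bounded by the lengths of
      the subpaths, so a lower bound of these lengths by chords suffices.\<close>
    have "ereal (dist x' (midpoint x' y')) \<le> path_len ?g 0 (?L / 2)"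
      using path_len_ge_dist[of 0 "?L / 2" ?g] unfolding half by (simp add: d dist_midpoint)
    moreover have "ereal (dist (midpoint x' y') y') \<le> path_len ?g (?L / 2) ?L"
      using path_len_ge_dist[of "?L / 2" ?L ?g] unfolding half by (simp add: d dist_midpoint)
    ultimately have "(?g (?L / 2), midpoint x' y') \<in> short_comparison ?g ?L x' y'"
      unfolding short_comparison_def by (auto intro!: exI[of _ "?L / 2"])
    moreover have "(z, z') \<in> short_comparison (straight y z) (dist y z) y' z'"
      unfolding short_comparison_def
      using path_len_ge_dist[of 0 "dist y z" "straight y z"]
        path_len_ge_dist[of "dist y z" "dist y z" "straight y z"]
      by (auto intro!: exI[of _ "dist y z"] simp: d)
    ultimately show "dist (midpoint x y) z \<le> dist (midpoint x' y') z' + K"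
      using K[rule_format, OF UNIV_I UNIV_I UNIV_I, of x y z, folded h_def,
          OF conjI[OF short_straight[OF h] conjI[OF short_straight[OF h] conjI[OF short_straight[OF h] tri]]]]
      by (fastforce simp: comparison_ineq_def straight_half)
  qed
qed

lemma parallelogram_of_CAT0:
  fixes a b :: "'a::real_normed_vector"
  assumes "CAT0_space (UNIV :: 'a set)"
  shows "(norm (a + b))\<^sup>2 + (norm (a - b))\<^sup>2 = 2 * (norm a)\<^sup>2 + 2 * (norm b)\<^sup>2"
proof (rule parallelogram_of_median_comparison[where K = 0])
  fix x y z :: 'a and x' y' z' :: "real^2"
  assume tri: "comparison_triangle x y z x' y' z'"
  define P where "P = geodesic_comparison (straight x y) (dist x y) x' y' \<union>
    geodesic_comparison (straight y z) (dist y z) y' z' \<union>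
    geodesic_comparison (straight z x) (dist z x) z' x'"
  have "comparison_ineq 0 P P"
    using assms tri geodesic_straight[of x y] geodesic_straight[of y z] geodesic_straight[of z x]
    unfolding CAT0_space_def Let_def P_def by blast
  moreover have d: "dist x' y' = dist x y" "dist y' z' = dist y z"
    using tri by (auto simp: comparison_triangle_def)
  have "(midpoint x y, midpoint x' y') \<in> P"
    unfolding P_def geodesic_comparison_def
    by (auto intro!: exI[of _ "dist x y / 2"] simp: d dist_midpoint straight_half)
  moreover have "(z, z') \<in> P"
    unfolding P_def geodesic_comparison_def
    by (auto intro!: exI[of _ "dist y z"] simp: d)
  ultimately show "dist (midpoint x y) z \<le> dist (midpoint x' y') z' + 0"
    by (fastforce simp: comparison_ineq_def)
qed

section \<open>Comparison from the parallelogram law\<close>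

text \<open>The common target of both kinds of comparison pairs: under the parallelogram law
  geodesic pairs belong to it, and short pairs do after moving the first point a bounded
  distance.\<close>

definition same_division ::
    "'a::real_normed_vector \<Rightarrow> 'a \<Rightarrow> real^2 \<Rightarrow> real^2 \<Rightarrow> ('a \<times> (real^2)) set" where
  "same_division x y x' y' =
    {((1 - s) *\<^sub>R x + s *\<^sub>R y, (1 - s) *\<^sub>R x' + s *\<^sub>R y') | s. 0 \<le> s \<and> s \<le> 1}"

text \<open>Stewart's formula expresses the distance from a division point to any point through
  distances to the ends of the side, and these agree with the ones in the plane.\<close>

lemma same_division_dist_eq:
  fixes x y z u v :: "'a::real_normed_vector" and x' y' z' :: "real^2"
  assumes par: "\<And>x y :: 'a. (norm (x + y))\<^sup>2 + (norm (x - y))\<^sup>2 = 2 * (norm x)\<^sup>2 + 2 * (norm y)\<^sup>2"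
    and tri: "comparison_triangle x y z x' y' z'"
    and P: "P = same_division x y x' y' \<union> same_division y z y' z' \<union> same_division z x z' x'"
    and u: "(u, u') \<in> P" and v: "(v, v') \<in> P"
  shows "dist u v = dist u' v'"
proof -
  have division: "dist p w = dist p' w'"
    if p: "(p, p') \<in> same_division a b a' b'" and ab: "dist a b = dist a' b'"
      "dist a w = dist a' w'" "dist b w = dist b' w'"
    for a b p w :: 'a and a' b' p' w' :: "real^2"
  proof -
    obtain s where s: "0 \<le> s" "s \<le> 1" "p = (1 - s) *\<^sub>R a + s *\<^sub>R b" "p' = (1 - s) *\<^sub>R a' + s *\<^sub>R b'"
      using p by (auto simp: same_division_def)
    have "(dist p w)\<^sup>2 = (dist p' w')\<^sup>2"
      unfolding s(3,4) stewart_parallelogram[OF par s(1,2)] stewart_inner by (simp add: ab)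
    then show ?thesis by simp
  qed
  have d: "dist x y = dist x' y'" "dist y z = dist y' z'" "dist z x = dist z' x'"
    using tri by (auto simp: comparison_triangle_def)
  have side: "dist p w = dist p' w'"
    if "(p, p') \<in> P" "dist x w = dist x' w'" "dist y w = dist y' w'" "dist z w = dist z' w'" for p p' w w'
    using that division d unfolding P by blast
  \<comment> \<open>Two rounds of the formula: first the distances from \<open>v\<close> to the
    vertices, then from \<open>u\<close> to \<open>v\<close>.\<close>
  have vertex: "dist v x = dist v' x'" "dist v y = dist v' y'" "dist v z = dist v' z'"
    using side[OF v, of x x'] side[OF v, of y y'] side[OF v, of z z'] d
    by (simp_all add: dist_commute)
  show ?thesis
    using side[OF u, of v v'] vertex by (simp add: dist_commute)
qed

text \<open>The point \<open>u\<close> has the same distances to \<open>x\<close> and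
  \<open>y\<close> as \<open>u'\<close> has to \<open>x'\<close> and \<open>y'\<close>. So its
  distance to the division point equals that of \<open>u'\<close> to itself, which is zero.\<close>

lemma geodesic_comparison_same_division:
  fixes x y :: "'a::real_normed_vector"
  assumes par: "\<And>x y :: 'a. (norm (x + y))\<^sup>2 + (norm (x - y))\<^sup>2 = 2 * (norm x)\<^sup>2 + 2 * (norm y)\<^sup>2"
    and g: "geodesic_segment UNIV g L x y" and d: "dist x' y' = dist x y"
  shows "geodesic_comparison g L x' y' \<subseteq> same_division x y x' y'"
proof clarify
  fix u u' assume "(u, u') \<in> geodesic_comparison g L x' y'"
  then have u': "u' \<in> closed_segment x' y'" "dist x' u' = dist x u" "dist u' y' = dist u y"
    using g by (auto simp: geodesic_comparison_def geodesic_segment_def path_from_to_def)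
  then obtain s where s: "0 \<le> s" "s \<le> 1" "u' = (1 - s) *\<^sub>R x' + s *\<^sub>R y'"
    by (auto simp: in_segment)
  have y': "dist y' u' = dist y u"
    using u'(3) by (simp add: dist_commute)
  have "(dist ((1 - s) *\<^sub>R x + s *\<^sub>R y) u)\<^sup>2 = (1 - s) * (dist x' u')\<^sup>2 + s * (dist y' u')\<^sup>2 - s * (1 - s) * (dist x' y')\<^sup>2"
    unfolding stewart_parallelogram[OF par s(1,2)] u'(2) y' d by (rule refl)
  also have "\<dots> = (dist ((1 - s) *\<^sub>R x' + s *\<^sub>R y') u')\<^sup>2"
    by (rule stewart_inner[symmetric])
  also have "\<dots> = 0"
    using s(3) by simp
  finally have "u = (1 - s) *\<^sub>R x + s *\<^sub>R y"
    by simp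
  then show "(u, u') \<in> same_division x y x' y'"
    using s by (auto simp: same_division_def)
qed

lemma CAT0_of_parallelogram:
  assumes par: "\<And>x y :: 'a::real_normed_vector.
    (norm (x + y))\<^sup>2 + (norm (x - y))\<^sup>2 = 2 * (norm x)\<^sup>2 + 2 * (norm y)\<^sup>2"
  shows "CAT0_space (UNIV :: 'a set)"
  unfolding CAT0_space_def Let_def
proof (intro conjI ballI allI impI geodesic_space_UNIV; elim conjE)
  fix x y z :: 'a and a A b B c C x' y' z'
  assume geo: "geodesic_segment UNIV a A x y" "geodesic_segment UNIV b B y z"
      "geodesic_segment UNIV c C z x"
    and tri: "comparison_triangle x y z x' y' z'"
  let ?P = "geodesic_comparison a A x' y' \<union> geodesic_comparison b B y' z' \<union> geodesic_comparison c C z' x'"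
  have "?P \<subseteq> same_division x y x' y' \<union> same_division y z y' z' \<union> same_division z x z' x'"
    using geo[THEN geodesic_comparison_same_division[OF par]] tri
    unfolding comparison_triangle_def by blast
  from subsetD[OF this] have "dist u v \<le> dist u' v' + 0" if "(u, u') \<in> ?P" "(v, v') \<in> ?P" for u u' v v'
    using same_division_dist_eq[OF par tri refl, of u u' v v'] that by (metis add.right_neutral order_refl)
  then show "comparison_ineq 0 ?P ?P"
    unfolding comparison_ineq_def by blast
qed

section \<open>Short segments under the parallelogram law\<close>

text \<open>Adding the chord over the rest of the path to a polygonal sum of a subpath gives a sum
  for the whole path. With \<open>r\<close> the distance from a comparison point to one end, this
  bounds the distance from \<open>g t\<close> to the other end.\<close>

lemma short_segment_dist_le:
  assumes g: "short_segment h X g L x y" and t: "t \<in> {0..L}"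
  shows "ereal r \<le> path_len g t L \<Longrightarrow> dist x (g t) + r \<le> dist x y + h"
    and "ereal r \<le> path_len g 0 t \<Longrightarrow> r + dist (g t) y \<le> dist x y + h"
proof -
  have ends: "g 0 = x" "g L = y" and len: "path_len g 0 L \<le> ereal (dist x y + h)"
    using g by (auto simp: short_segment_def path_from_to_def)
  have bound: "(\<Sum>i<length ts - 1. dist (g (ts ! i)) (g (ts ! Suc i))) \<le> dist x y + h"
    if "sorted ts" "set ts \<subseteq> {0..L}" for ts
    using order_trans[OF path_len_ge_sum[OF that] len] by simp
  show "dist x (g t) + r \<le> dist x y + h" if r: "ereal r \<le> path_len g t L"
  proof -
    have "path_len g t L \<le> ereal (dist x y + h - dist x (g t))"
      unfolding path_len_def
    proof (rule SUP_least)
      fix ts assume "ts \<in> {ts. sorted ts \<and> set ts \<subseteq> {t..L}}"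
      then have ts: "sorted (0 # t # ts)" "set (0 # t # ts) \<subseteq> {0..L}"
        using t by fastforce+
      have "dist x (g t) + (\<Sum>i<length ts - 1. dist (g (ts ! i)) (g (ts ! Suc i)))
          \<le> (\<Sum>i<length (0 # t # ts) - 1. dist (g ((0 # t # ts) ! i)) (g ((0 # t # ts) ! Suc i)))"
        by (cases ts) (simp_all add: ends sum.lessThan_Suc_shift del: sum.lessThan_Suc)
      also have "\<dots> \<le> dist x y + h"
        by (rule bound[OF ts])
      finally show "ereal (\<Sum>i<length ts - 1. dist (g (ts ! i)) (g (ts ! Suc i)))
          \<le> ereal (dist x y + h - dist x (g t))"
        by simp
    qed
    from order_trans[OF r this] show ?thesis by simp
  qed
  show "r + dist (g t) y \<le> dist x y + h" if r: "ereal r \<le> path_len g 0 t"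
  proof -
    have "path_len g 0 t \<le> ereal (dist x y + h - dist (g t) y)"
      unfolding path_len_def
    proof (rule SUP_least)
      fix ts assume *: "ts \<in> {ts. sorted ts \<and> set ts \<subseteq> {0..t}}"
      let ?us = "ts @ [t, L]"
      have us: "sorted ?us" "set ?us \<subseteq> {0..L}"
        using t * by (fastforce simp: sorted_append)+
      define f where "f i = dist (g (?us ! i)) (g (?us ! Suc i))" for i
      have "(\<Sum>i<length ts - 1. dist (g (ts ! i)) (g (ts ! Suc i))) = (\<Sum>i<length ts - 1. f i)"
        by (intro sum.cong) (auto simp: f_def nth_append)
      \<comment> \<open>The extra term is the link from the last entry of \<open>ts\<close> to
        \<open>t\<close>; for empty \<open>ts\<close> both sums are empty.\<close>
      also have "\<dots> \<le> (\<Sum>i<length ts. f i)"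
        by (intro sum_mono2) (auto simp: f_def)
      finally have "(\<Sum>i<length ts - 1. dist (g (ts ! i)) (g (ts ! Suc i))) + dist (g t) y
          \<le> (\<Sum>i<length ts. f i) + f (length ts)"
        by (simp add: f_def nth_append ends)
      also have "\<dots> = (\<Sum>i<length ?us - 1. f i)"
        by simp
      also have "\<dots> \<le> dist x y + h"
        unfolding f_def by (rule bound[OF us])
      finally show "ereal (\<Sum>i<length ts - 1. dist (g (ts ! i)) (g (ts ! Suc i)))
          \<le> ereal (dist x y + h - dist (g t) y)"
        by simp
    qed
    from order_trans[OF r this] show ?thesis by simp
  qed
qed

text \<open>Both end distances of \<open>u\<close> exceed those of the division point by at most
  \<open>h\<close>. In Stewart's formula this excess costs a multiple of \<open>h * dist x y\<close>
  plus \<open>h\<^sup>2\<close>, which explains why \<open>h\<close> is inverse to the size of the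
  triangle.\<close>

lemma short_comparison_near_division:
  fixes x y :: "'a::real_normed_vector"
  assumes par: "\<And>x y :: 'a. (norm (x + y))\<^sup>2 + (norm (x - y))\<^sup>2 = 2 * (norm x)\<^sup>2 + 2 * (norm y)\<^sup>2"
    and g: "short_segment h UNIV g L x y" and d: "dist x' y' = dist x y"
    and h: "0 \<le> h" "h \<le> 1" "h * dist x y \<le> 1"
    and u: "(u, u') \<in> short_comparison g L x' y'"
  shows "\<exists>p. (p, u') \<in> same_division x y x' y' \<and> dist u p \<le> 2"
proof -
  obtain t s where t: "t \<in> {0..L}" "u = g t"
    and len: "ereal (dist x' u') \<le> path_len g 0 t" "ereal (dist u' y') \<le> path_len g t L"
    and s: "0 \<le> s" "s \<le> 1" "u' = (1 - s) *\<^sub>R x' + s *\<^sub>R y'"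
    using u by (auto simp: short_comparison_def in_segment)
  define D where "D = dist x y"
  define p where "p = (1 - s) *\<^sub>R x + s *\<^sub>R y"
  have "x' - u' = s *\<^sub>R (x' - y')" "u' - y' = (1 - s) *\<^sub>R (x' - y')"
    by (simp_all add: s(3) algebra_simps)
  then have "dist x' u' = s * D" "dist u' y' = (1 - s) * D"
    using s(1,2) d by (simp_all add: dist_norm D_def)
  then have "dist x u \<le> s * D + h" "dist y u \<le> (1 - s) * D + h"
    using short_segment_dist_le(1)[OF g t(1) len(2)] short_segment_dist_le(2)[OF g t(1) len(1)]
    by (auto simp: t(2) D_def[symmetric] dist_commute[of y] algebra_simps)
  then have sq: "(dist x u)\<^sup>2 \<le> (s * D + h)\<^sup>2" "(dist y u)\<^sup>2 \<le> ((1 - s) * D + h)\<^sup>2"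
    by (simp_all add: power_mono)
  have "(dist p u)\<^sup>2 = (1 - s) * (dist x u)\<^sup>2 + s * (dist y u)\<^sup>2 - s * (1 - s) * D\<^sup>2"
    unfolding p_def D_def by (rule stewart_parallelogram[OF par s(1,2)])
  also have "\<dots> \<le> (1 - s) * (s * D + h)\<^sup>2 + s * ((1 - s) * D + h)\<^sup>2 - s * (1 - s) * D\<^sup>2"
    using s sq by (intro diff_right_mono add_mono mult_left_mono) auto
  \<comment> \<open>The terms in \<open>D\<^sup>2\<close> cancel, so only the product
    \<open>h * D\<close> has to be controlled.\<close>
  also have "\<dots> = (4 * (s * (1 - s))) * (h * D) + h\<^sup>2"
    by (simp add: power2_eq_square algebra_simps)
  also have "\<dots> \<le> 1 * 1 + 1"
  proof (intro add_mono mult_mono)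
    show "4 * (s * (1 - s)) \<le> 1"
      using zero_le_power2[of "2 * s - 1"] by (simp add: power2_eq_square algebra_simps)
    show "h\<^sup>2 \<le> 1" using h by (simp add: power_le_one)
  qed (use h in \<open>auto simp: D_def\<close>)
  \<comment> \<open>The bound \<open>sqrt 2\<close> is rounded up to 2.\<close>
  also have "\<dots> \<le> 2\<^sup>2" by simp
  finally have "dist p u \<le> 2"
    by (rule power2_le_imp_le) simp
  moreover have "(p, u') \<in> same_division x y x' y'"
    using s by (auto simp: same_division_def p_def)
  ultimately show ?thesis
    by (metis dist_commute)
qed

text \<open>The constant 4 is twice the error 2 made in replacing a point of a short side by its
  division point; between division points the comparison is exact.\<close>

lemma rCAT0_of_parallelogram:
  assumes par: "\<And>x y :: 'a::real_normed_vector.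
    (norm (x + y))\<^sup>2 + (norm (x - y))\<^sup>2 = 2 * (norm x)\<^sup>2 + 2 * (norm y)\<^sup>2"
  shows "rCAT0_space (UNIV :: 'a set)"
  unfolding rCAT0_space_def Let_def
proof (intro conjI length_space_UNIV exI[of _ 4] ballI allI impI; (elim conjE)?)
  fix x y z :: 'a and a b c :: "real \<Rightarrow> 'a" and A B C x' y' z'
  define h where "h = 1 / Max {1, dist x y, dist x z, dist y z}"
  let ?S = "short_comparison a A x' y' \<union> short_comparison b B y' z' \<union> short_comparison c C z' x'"
  assume "short_segment (1 / Max {1, dist x y, dist x z, dist y z}) UNIV a A x y"
    "short_segment (1 / Max {1, dist x y, dist x z, dist y z}) UNIV b B y z"
    "short_segment (1 / Max {1, dist x y, dist x z, dist y z}) UNIV c C z x"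
  then have short: "short_segment h UNIV a A x y" "short_segment h UNIV b B y z"
    "short_segment h UNIV c C z x"
    by (simp_all only: h_def)
  assume tri: "comparison_triangle x y z x' y' z'"
  then have d: "dist x' y' = dist x y" "dist y' z' = dist y z" "dist z' x' = dist z x"
    by (auto simp: comparison_triangle_def)
  define M where "M = Max {1, dist x y, dist x z, dist y z}"
  have M: "1 \<le> M" "dist x y \<le> M" "dist z x \<le> M" "dist y z \<le> M"
    unfolding M_def by (auto intro!: Max_ge simp: dist_commute)
  have h: "0 \<le> h" "h \<le> 1" "h * dist x y \<le> 1" "h * dist y z \<le> 1" "h * dist z x \<le> 1"
    using M unfolding h_def M_def[symmetric] by simp_all
  define P where "P = same_division x y x' y' \<union> same_division y z y' z' \<union> same_division z x z' x'"
  have near: "\<exists>p. (p, u') \<in> P \<and> dist u p \<le> 2" if "(u, u') \<in> ?S" for u u'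
    using that short_comparison_near_division[OF par short(1) d(1) h(1,2,3)]
      short_comparison_near_division[OF par short(2) d(2) h(1,2,4)]
      short_comparison_near_division[OF par short(3) d(3) h(1,2,5)]
    unfolding P_def by blast
  have bound: "dist u v \<le> dist u' v' + 4" if uv: "(u, u') \<in> ?S" "(v, v') \<in> ?S" for u u' v v'
  proof -
    obtain p q where p: "(p, u') \<in> P" "dist u p \<le> 2" and q: "(q, v') \<in> P" "dist v q \<le> 2"
      using near[OF uv(1)] near[OF uv(2)] by blast
    have "dist p q = dist u' v'"
      by (rule same_division_dist_eq[OF par tri P_def p(1) q(1)])
    moreover have "dist u v \<le> dist u p + (dist p q + dist v q)"
      using dist_triangle[of u v p] dist_triangle[of p v q] by (simp add: dist_commute)
    ultimately show ?thesis using p(2) q(2) by linarith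
  qed
  show "comparison_ineq 4 (short_comparison a A x' y') (short_comparison b B y' z')"
    "comparison_ineq 4 (short_comparison b B y' z') (short_comparison c C z' x')"
    "comparison_ineq 4 (short_comparison a A x' y') (short_comparison c C z' x')"
    using bound unfolding comparison_ineq_def by blast+
qed simp

theorem proposition5p11:
  shows "rCAT0_space (UNIV :: 'a::real_normed_vector set) \<longleftrightarrow> CAT0_space (UNIV :: 'a set)"
  using CAT0_of_parallelogram parallelogram_of_rCAT0 rCAT0_of_parallelogram parallelogram_of_CAT0
  by blast

end
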